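(* Let $p\in(0,1)$. For every $\bar u\in L^1(\Omega)$, \[ \widehat{\partial} q_{1,p}(\bar u)=\begin{cases}\{0\} & \text{if } \bar u=0 \text{ a.e. on } \Omega,\\ \varnothing & \text{otherwise.}\end{cases} \]
   Context: $\Omega\subset\mathbb{R}^d$ is a Lebesgue-measurable set with positive and finite Lebesgue measure. $L^1(\Omega)$ is the usual real Lebesgue space with norm $\Vert\cdot\Vert_1$, and its dual is identified with $L^\infty(\Omega)$. For $p\in(0,1)$ the functional $q_{1,p}\colon L^1(\Omega)\to\mathbb{R}$ is $q_{1,p}(u):=\int_\Omega |u(x)|^p\,\mathrm{d}x$. The Fréchet subdifferential of $q_{1,p}$ at $\bar u\in L^1(\Omega)$ is \[ \widehat{\partial} q_{1,p}(\bar u):=\Bigl\{\eta\in L^\infty(\Omega) : \liminf_{\Vert h\Vert_1\searrow 0}\frac{q_{1,p}(\bar u+h)-q_{1,p}(\bar u)-\int_\Omega\eta(x)h(x)\,\mathrm{d}x}{\Vert h\Vert_1}\ge 0\Bigr\}, \] where the lower limit is over $h\in L^1(\Omega)\setminus\{0\}$ with $\Vert h\Vert_1\to 0$. *)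

theory Defs
  imports "HOL-Probability.Probability"
begin

text \<open>
  Elements of Lebesgue spaces are represented by functions and are not quotiented by equality
  almost everywhere: a set of equivalence classes corresponds to the set of all their
  representatives. With \<open>M = lebesgue_on \<Omega>\<close>, all notions below ignore values outside \<open>\<Omega>\<close>.
\<close>

definition L1 :: "'a measure \<Rightarrow> ('a \<Rightarrow> real) set" where
  "L1 M = {u. integrable M u}"

definition L1_norm :: "'a measure \<Rightarrow> ('a \<Rightarrow> real) \<Rightarrow> real" where
  "L1_norm M u = (LINT x|M. \<bar>u x\<bar>)"

definition Linf :: "'a measure \<Rightarrow> ('a \<Rightarrow> real) set" where
  "Linf M = {\<eta> \<in> borel_measurable M. esssup M (\<lambda>x. ereal \<bar>\<eta> x\<bar>) < \<infinity>}"

definition q1 :: "'a measure \<Rightarrow> real \<Rightarrow> ('a \<Rightarrow> real) \<Rightarrow> real" where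
  "q1 M p u = (LINT x|M. \<bar>u x\<bar> powr p)"

text \<open>
  The filter of \<open>h\<close> in \<open>L1 M\<close> with norm tending to \<open>0\<close>; since \<^term>\<open>at_right 0\<close> only sees
  positive norms, it excludes exactly the representatives of \<open>0\<close>.
\<close>

definition L1_to_zero :: "'a measure \<Rightarrow> ('a \<Rightarrow> real) filter" where
  "L1_to_zero M = inf (filtercomap (L1_norm M) (at_right 0)) (principal (L1 M))"

definition frechet_subdiff ::
  "'a measure \<Rightarrow> (('a \<Rightarrow> real) \<Rightarrow> real) \<Rightarrow> ('a \<Rightarrow> real) \<Rightarrow> ('a \<Rightarrow> real) set" where
  "frechet_subdiff M F u =
     {\<eta> \<in> Linf M.
        Liminf (L1_to_zero M)
          (\<lambda>h. ereal ((F (\<lambda>x. u x + h x) - F u - (LINT x|M. \<eta> x * h x)) / L1_norm M h)) \<ge> 0}"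

end

theory Submission
  imports Defs
begin

text \<open>
  By subadditivity of \<open>t \<mapsto> \<bar>t\<bar> powr p\<close>, adding \<open>h = \<plusminus>s\<close> on a small set \<open>A\<close> raises the functional by
  at most \<open>s powr p * \<bar>A\<bar>\<close>, while \<open>\<parallel>h\<parallel> = s * \<bar>A\<bar>\<close>. Their quotient \<open>s powr (p - 1)\<close> is arbitrarily
  small for large \<open>s\<close>, and \<open>\<bar>A\<bar>\<close> may still tend to \<open>0\<close> since Lebesgue measure has no atoms; hence
  every subgradient, at any point, vanishes almost everywhere. If \<open>0 < \<bar>u\<bar> \<le> K\<close> on a set of positive
  measure, then erasing \<open>u\<close> on small subsets of it lowers the functional by at least
  \<open>K powr (p - 1) * \<parallel>h\<parallel>\<close>, so \<open>0\<close> is not a subgradient.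
\<close>

section \<open>Powers with exponent between 0 and 1: subadditivity and integrability\<close>

lemma powr_abs_add_le:
  fixes a b p :: real
  assumes "0 \<le> p" "p \<le> 1"
  shows "\<bar>a + b\<bar> powr p \<le> \<bar>a\<bar> powr p + \<bar>b\<bar> powr p"
proof (cases "a = 0 \<or> b = 0")
  case False
  define x y where "x = \<bar>a\<bar>" and "y = \<bar>b\<bar>"
  have pos: "0 < x" "0 < y" using False by (auto simp: x_def y_def)
  have "\<bar>a + b\<bar> powr p \<le> (x + y) powr p"
    unfolding x_def y_def using assms by (intro powr_mono2) auto
  \<comment> \<open>Splitting off one factor \<open>x + y\<close> leaves the exponent
    \<open>p - 1 <= 0\<close>. The power is then antitone, so replacing \<open>x + y\<close> by
    \<open>x\<close> or by \<open>y\<close> only increases each summand.\<close>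
  also have "\<dots> = x * (x + y) powr (p - 1) + y * (x + y) powr (p - 1)"
    using pos powr_add[of "x + y" "p - 1" 1] by (simp add: algebra_simps)
  also have "\<dots> \<le> x * x powr (p - 1) + y * y powr (p - 1)"
    using pos assms by (intro add_mono mult_left_mono powr_mono2') auto
  also have "\<dots> = x powr p + y powr p"
    using pos powr_add[of x "p - 1" 1] powr_add[of y "p - 1" 1] by (simp add: algebra_simps)
  finally show ?thesis by (simp add: x_def y_def)
qed auto

text \<open>The bound \<open>t powr p <= 1 + t\<close> for \<open>t >= 0\<close> suffices, since
  constants are integrable over a finite measure. It ensures that \<open>q1\<close> at an integrable
  function is a genuine integral and not the default value 0.\<close>

lemma (in finite_measure) integrable_abs_powr:
  fixes u :: "'a \<Rightarrow> real"
  assumes "integrable M u" "0 \<le> p" "p \<le> 1"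
  shows "integrable M (\<lambda>x. \<bar>u x\<bar> powr p)"
proof (rule Bochner_Integration.integrable_bound)
  show "integrable M (\<lambda>x. 1 + \<bar>u x\<bar>)" using assms by simp
  show "(\<lambda>x. \<bar>u x\<bar> powr p) \<in> borel_measurable M" using assms(1) by measurable
  have "y powr p \<le> 1 + y" if "0 \<le> y" for y :: real
  proof (cases "y \<le> 1")
    case True
    then show ?thesis using powr_mono2[of p y 1] assms that by auto
  next
    case False
    then show ?thesis using powr_mono[of p 1 y] assms by auto
  qed
  then show "AE x in M. norm (\<bar>u x\<bar> powr p) \<le> norm (1 + \<bar>u x\<bar>)" by simp
qed

section \<open>Unfolding essential boundedness and the subdifferential\<close>

lemma AE_bound_of_Linf:
  assumes "\<eta> \<in> Linf M"
  obtains C where "AE x in M. \<bar>\<eta> x\<bar> \<le> C"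
proof -
  define S where "S = esssup M (\<lambda>x. ereal \<bar>\<eta> x\<bar>)"
  have "S < \<infinity>" using assms by (simp add: Linf_def S_def)
  \<comment> \<open>Only an upper bound is taken, because \<open>S\<close> is minus infinity on a
    null measure.\<close>
  then obtain C where C: "S \<le> ereal C"
    by (cases S) auto
  have "AE x in M. ereal \<bar>\<eta> x\<bar> \<le> S"
    unfolding S_def by (rule esssup_AE)
  then have "AE x in M. \<bar>\<eta> x\<bar> \<le> C"
    by eventually_elim (use C in \<open>metis ereal_less_eq(3) order_trans\<close>)
  then show thesis by (rule that)
qed

text \<open>A nonnegative lower limit means that the quotient eventually exceeds each
  \<open>- e < 0\<close>. Multiplying by the positive norm clears the denominator and gives an
  epsilon-delta form in which test functions \<open>h\<close> can be inserted.\<close>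

lemma frechet_subdiffD:
  assumes "\<eta> \<in> frechet_subdiff M F u" "0 < e"
  obtains d where "0 < d"
    "\<And>h. integrable M h \<Longrightarrow> 0 < L1_norm M h \<Longrightarrow> L1_norm M h < d \<Longrightarrow>
       - e * L1_norm M h \<le> F (\<lambda>x. u x + h x) - F u - (LINT x|M. \<eta> x * h x)"
proof -
  let ?Q = "\<lambda>h. (F (\<lambda>x. u x + h x) - F u - (LINT x|M. \<eta> x * h x)) / L1_norm M h"
  have "0 \<le> Liminf (L1_to_zero M) (\<lambda>h. ereal (?Q h))"
    using assms(1) by (simp add: frechet_subdiff_def)
  moreover have "ereal (- e) < 0" using assms(2) by simp
  ultimately have "\<forall>\<^sub>F h in L1_to_zero M. ereal (- e) < ereal (?Q h)"
    unfolding le_Liminf_iff by blast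
  then have "\<forall>\<^sub>F h in filtercomap (L1_norm M) (at_right 0). h \<in> L1 M \<longrightarrow> - e < ?Q h"
    unfolding L1_to_zero_def eventually_inf_principal by simp
  then obtain P where P: "eventually P (at_right (0::real))"
      "\<And>h. P (L1_norm M h) \<Longrightarrow> h \<in> L1 M \<Longrightarrow> - e < ?Q h"
    unfolding eventually_filtercomap by blast
  then obtain d where "0 < d" and d: "\<And>y. 0 < y \<Longrightarrow> y < d \<Longrightarrow> P y"
    unfolding eventually_at_right_field by blast
  show thesis
  proof (rule that[OF \<open>0 < d\<close>])
    fix h assume "integrable M h" and h: "0 < L1_norm M h" "L1_norm M h < d"
    then have "- e < ?Q h" by (intro P d) (auto simp: L1_def)
    then show "- e * L1_norm M h \<le> F (\<lambda>x. u x + h x) - F u - (LINT x|M. \<eta> x * h x)"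
      using h by (simp add: pos_less_divide_eq)
  qed
qed

section \<open>Subgradients over a finite measure without atoms\<close>

locale nonatomic_finite_measure = finite_measure +
  assumes ex_small_subset:
    "E \<in> sets M \<Longrightarrow> 0 < measure M E \<Longrightarrow> 0 < e \<Longrightarrow>
       \<exists>A \<in> sets M. A \<subseteq> E \<and> 0 < measure M A \<and> measure M A < e"
begin

lemma AE_or_measure_pos:
  assumes "Measurable.pred M P"
  shows "(AE x in M. P x) \<or> 0 < measure M {x \<in> space M. \<not> P x}"
proof -
  have "{x \<in> space M. \<not> P x} \<in> sets M" using assms by measurable
  then show ?thesis
    using AE_iff_measurable[OF _ refl, of M P] zero_less_measure_iff emeasure_eq_measure
    by (metis ennreal_0 zero_less_measure_iff)
qed

text \<open>The sign \<open>\<sigma>\<close> treats upper and lower bounds at once. If the bound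
  fails on a set \<open>E\<close> of positive measure, a bump of height \<open>s\<close> and sign
  \<open>\<sigma>\<close> on a small part of \<open>E\<close> gains more in the linear term than it
  costs in \<open>q1\<close>.\<close>

lemma subgradient_AE_le:
  assumes \<eta>: "\<eta> \<in> frechet_subdiff M (q1 M p) u" and u: "integrable M u"
    and p: "0 < p" "p < 1" and \<sigma>: "\<bar>\<sigma>\<bar> = 1" and e: "0 < e"
  shows "AE x in M. \<sigma> * \<eta> x \<le> e"
proof (rule ccontr)
  assume not_AE: "\<not> (AE x in M. \<sigma> * \<eta> x \<le> e)"
  define E where "E = {x \<in> space M. \<not> \<sigma> * \<eta> x \<le> e}"
  have \<eta>_Linf: "\<eta> \<in> Linf M" using \<eta> by (simp add: frechet_subdiff_def)
  then have [measurable]: "\<eta> \<in> borel_measurable M" by (simp add: Linf_def)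
  obtain C where C: "AE x in M. \<bar>\<eta> x\<bar> \<le> C" using \<eta>_Linf by (rule AE_bound_of_Linf)
  have int_\<eta>: "integrable M \<eta>"
    using C by (intro integrable_const_bound[of _ C]) auto
  have "E \<in> sets M" unfolding E_def by measurable
  have "0 < measure M E"
    using AE_or_measure_pos[of "\<lambda>x. \<sigma> * \<eta> x \<le> e"] not_AE by (simp add: E_def)
  \<comment> \<open>The height solves \<open>s powr (p - 1) = e / 4\<close>, so the bump costs at
    most \<open>e / 4\<close> times its norm. It does not depend on \<open>A\<close>; the norm
    \<open>s * measure M A\<close> is brought below \<open>d\<close> by shrinking \<open>A\<close>
    alone.\<close>
  define s where "s = (e / 4) powr (1 / (p - 1))"
  have s: "0 < s" using e by (simp add: s_def)
  have s_powr: "s powr p = e / 4 * s"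
  proof -
    have "s powr (p - 1) = e / 4" using e p by (simp add: s_def powr_powr)
    then show ?thesis using powr_add[of s "p - 1" 1] s by simp
  qed
  obtain d where d: "0 < d"
    "\<And>h. integrable M h \<Longrightarrow> 0 < L1_norm M h \<Longrightarrow> L1_norm M h < d \<Longrightarrow>
       - (e / 2) * L1_norm M h \<le> q1 M p (\<lambda>x. u x + h x) - q1 M p u - (LINT x|M. \<eta> x * h x)"
    using frechet_subdiffD[OF \<eta>, of "e / 2"] e by auto
  obtain A where A: "A \<in> sets M" "A \<subseteq> E" "0 < measure M A" "measure M A < d / s"
    using ex_small_subset[OF \<open>E \<in> sets M\<close> \<open>0 < measure M E\<close>, of "d / s"] d(1) s by auto
  define h where "h = (\<lambda>x. \<sigma> * s * indicator A x :: real)"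
  have int_A: "integrable M (indicator A :: 'a \<Rightarrow> real)"
    using A by (simp add: emeasure_eq_measure)
  have int_h: "integrable M h" unfolding h_def using int_A by simp
  have abs_h: "\<bar>h x\<bar> = s * indicator A x" for x
    using s \<sigma> by (simp add: h_def abs_mult)
  have norm_h: "L1_norm M h = s * measure M A"
    using A by (simp add: L1_norm_def abs_h)
  have "- (e / 2) * (s * measure M A) \<le>
      q1 M p (\<lambda>x. u x + h x) - q1 M p u - (LINT x|M. \<eta> x * h x)"
    using d(2)[OF int_h] A s unfolding norm_h by (simp add: pos_less_divide_eq mult.commute)
  moreover have "q1 M p (\<lambda>x. u x + h x) \<le> q1 M p u + s powr p * measure M A"
  proof -
    have "q1 M p (\<lambda>x. u x + h x) \<le> (LINT x|M. \<bar>u x\<bar> powr p + s powr p * indicator A x)"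
      unfolding q1_def
    proof (rule integral_mono)
      show "integrable M (\<lambda>x. \<bar>u x + h x\<bar> powr p)"
        using int_h u p by (intro integrable_abs_powr) auto
      show "integrable M (\<lambda>x. \<bar>u x\<bar> powr p + s powr p * indicator A x)"
        using u p int_A by (intro Bochner_Integration.integrable_add integrable_abs_powr) auto
      show "\<bar>u x + h x\<bar> powr p \<le> \<bar>u x\<bar> powr p + s powr p * indicator A x" for x
        using powr_abs_add_le[of p "u x" "h x"] p abs_h[of x]
        by (auto simp: indicator_def split: if_splits)
    qed
    also have "\<dots> = q1 M p u + s powr p * measure M A"
      unfolding q1_def using u p int_A A
      by (subst Bochner_Integration.integral_add) (auto intro: integrable_abs_powr)
    finally show ?thesis .
  qed
  moreover have "e * s * measure M A \<le> (LINT x|M. \<eta> x * h x)"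
  proof -
    have "e * s * measure M A = (LINT x|M. e * s * indicator A x)" using A by simp
    also have "\<dots> \<le> (LINT x|M. \<eta> x * h x)"
    proof (rule integral_mono)
      show "integrable M (\<lambda>x. e * s * indicator A x)" using int_A by simp
      have "integrable M (\<lambda>x. \<sigma> * s * (\<eta> x * indicator A x))"
        using integrable_mult_indicator[OF A(1) int_\<eta>] by (simp add: mult.commute)
      then show "integrable M (\<lambda>x. \<eta> x * h x)" by (simp add: h_def algebra_simps)
      show "e * s * indicator A x \<le> \<eta> x * h x" for x
      proof (cases "x \<in> A")
        case True
        then have "e \<le> \<sigma> * \<eta> x" using A(2) by (auto simp: E_def)
        then have "e * s \<le> \<sigma> * \<eta> x * s" using s by (intro mult_right_mono) auto
        then show ?thesis using True by (simp add: h_def algebra_simps)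
      qed (simp add: h_def)
    qed
    finally show ?thesis .
  qed
  \<comment> \<open>Per unit of norm this reads \<open>- e / 2 <= e / 4 - e\<close>, which is
    impossible.\<close>
  ultimately have "- (e / 2) * (s * measure M A) \<le> e / 4 * s * measure M A - e * s * measure M A"
    unfolding s_powr by linarith
  moreover have "0 < e * s * measure M A" using e s A by simp
  ultimately show False by (simp add: algebra_simps)
qed

lemma subgradient_AE_eq_0:
  assumes "\<eta> \<in> frechet_subdiff M (q1 M p) u" "integrable M u" "0 < p" "p < 1"
  shows "AE x in M. \<eta> x = 0"
proof -
  \<comment> \<open>Countably many bounds \<open>1 / Suc n\<close>, for both signs, keep the union
    of the exceptional sets null.\<close>
  have "AE x in M. \<forall>n. 1 * \<eta> x \<le> 1 / real (Suc n) \<and> - 1 * \<eta> x \<le> 1 / real (Suc n)"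
    unfolding AE_all_countable
    by (intro allI AE_conjI subgradient_AE_le[OF assms]) auto
  then show ?thesis
  proof eventually_elim
    case (elim x)
    then have "\<bar>\<eta> x\<bar> \<le> 1 / real (Suc n)" for n by (auto simp: abs_le_iff)
    then show ?case
      by (metis nat_approx_posE not_le zero_less_abs_iff)
  qed
qed

lemma AE_eq_0_of_subgradient:
  assumes \<eta>: "\<eta> \<in> frechet_subdiff M (q1 M p) u" and u: "integrable M u" and p: "0 < p" "p < 1"
  shows "AE x in M. u x = 0"
proof (rule ccontr)
  assume not_AE: "\<not> (AE x in M. u x = 0)"
  have [measurable]: "u \<in> borel_measurable M" using u by simp
  \<comment> \<open>The sets where \<open>0 < |u| <= n\<close> exhaust the set where
    \<open>u\<close> is nonzero, so they cannot all be null.\<close>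
  have "\<exists>n. \<not> (AE x in M. \<not> (0 < \<bar>u x\<bar> \<and> \<bar>u x\<bar> \<le> real n))"
  proof (rule ccontr)
    assume "\<not> ?thesis"
    then have "AE x in M. \<forall>n. \<not> (0 < \<bar>u x\<bar> \<and> \<bar>u x\<bar> \<le> real n)"
      unfolding AE_all_countable by blast
    then have "AE x in M. u x = 0"
      by eventually_elim (metis real_arch_simple zero_less_abs_iff)
    with not_AE show False ..
  qed
  then obtain n where n: "\<not> (AE x in M. \<not> (0 < \<bar>u x\<bar> \<and> \<bar>u x\<bar> \<le> real n))" ..
  \<comment> \<open>The successor makes \<open>K\<close> positive without a case distinction on
    \<open>n\<close>.\<close>
  define K where "K = real (Suc n)"
  have K: "0 < K" "real n \<le> K" by (simp_all add: K_def)
  define E where "E = {x \<in> space M. 0 < \<bar>u x\<bar> \<and> \<bar>u x\<bar> \<le> real n}"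
  have "E \<in> sets M" unfolding E_def by measurable
  have "0 < measure M E"
    using AE_or_measure_pos[of "\<lambda>x. \<not> (0 < \<bar>u x\<bar> \<and> \<bar>u x\<bar> \<le> real n)"] n by (simp add: E_def)
  \<comment> \<open>On \<open>A\<close> one has \<open>0 < |u| <= K\<close>, hence
    \<open>|u| powr (p - 1) >= c\<close>. Erasing \<open>u\<close> there thus lowers the integrand
    by \<open>|u| powr p >= c * |u|\<close>, while the slack allowed to the subgradient is only
    \<open>c / 2\<close>.\<close>
  define c where "c = K powr (p - 1)"
  have c: "0 < c" using K by (simp add: c_def)
  obtain d where d: "0 < d"
    "\<And>h. integrable M h \<Longrightarrow> 0 < L1_norm M h \<Longrightarrow> L1_norm M h < d \<Longrightarrow>
       - (c / 2) * L1_norm M h \<le> q1 M p (\<lambda>x. u x + h x) - q1 M p u - (LINT x|M. \<eta> x * h x)"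
    using frechet_subdiffD[OF \<eta>, of "c / 2"] c by auto
  obtain A where A: "A \<in> sets M" "A \<subseteq> E" "0 < measure M A" "measure M A < d / K"
    using ex_small_subset[OF \<open>E \<in> sets M\<close> \<open>0 < measure M E\<close>, of "d / K"] d(1) K by auto
  define h where "h = (\<lambda>x. - (indicator A x * u x))"
  have int_h: "integrable M h"
    unfolding h_def using integrable_mult_indicator[OF A(1) u] by simp
  have in_A: "0 < \<bar>u x\<bar>" "\<bar>u x\<bar> \<le> K" if "x \<in> A" for x
    using that A(2) K(2) by (auto simp: E_def)
  have "L1_norm M h \<le> (LINT x|M. K * indicator A x)"
    unfolding L1_norm_def
  proof (rule integral_mono)
    show "integrable M (\<lambda>x. K * indicator A x)" using A by (simp add: emeasure_eq_measure)
    show "\<bar>h x\<bar> \<le> K * indicator A x" for x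
      using in_A[of x] by (auto simp: h_def indicator_def)
  qed (use int_h in simp)
  also have "\<dots> < d" using A K by (simp add: pos_less_divide_eq mult.commute)
  finally have norm_less: "L1_norm M h < d" .
  \<comment> \<open>Positivity must be checked since the lower limit ranges over \<open>h\<close> of
    positive norm only; it holds because \<open>u\<close> has no zero on \<open>A\<close>.\<close>
  have norm_pos: "0 < L1_norm M h"
  proof (rule ccontr)
    assume "\<not> ?thesis"
    then have "L1_norm M h = 0"
      unfolding L1_norm_def by (smt (verit) integral_nonneg_AE AE_I2 abs_ge_zero)
    then have "AE x in M. \<bar>h x\<bar> = 0"
      unfolding L1_norm_def using int_h by (subst (asm) integral_nonneg_eq_0_iff_AE) auto
    then have "AE x in M. x \<notin> A"
      by eventually_elim (use in_A in \<open>auto simp: h_def\<close>)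
    then have "measure M A = 0"
      using A(1) by (simp add: AE_iff_null_sets measure_eq_0_null_sets)
    with A(3) show False by simp
  qed
  \<comment> \<open>The linear term drops out, as every subgradient vanishes almost
    everywhere.\<close>
  have "AE x in M. \<eta> x * h x = 0"
    using subgradient_AE_eq_0[OF \<eta> u p] by eventually_elim simp
  then have "(LINT x|M. \<eta> x * h x) = 0" by (rule integral_eq_zero_AE)
  then have "- (c / 2) * L1_norm M h \<le> q1 M p (\<lambda>x. u x + h x) - q1 M p u"
    using d(2)[OF int_h norm_pos norm_less] by simp
  also have "q1 M p (\<lambda>x. u x + h x) \<le> (LINT x|M. \<bar>u x\<bar> powr p - c * \<bar>h x\<bar>)"
    unfolding q1_def
  proof (rule integral_mono)
    show "integrable M (\<lambda>x. \<bar>u x + h x\<bar> powr p)"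
      using int_h u p by (intro integrable_abs_powr) auto
    show "integrable M (\<lambda>x. \<bar>u x\<bar> powr p - c * \<bar>h x\<bar>)"
      using int_h u p by (intro Bochner_Integration.integrable_diff integrable_abs_powr) auto
    show "\<bar>u x + h x\<bar> powr p \<le> \<bar>u x\<bar> powr p - c * \<bar>h x\<bar>" for x
    proof (cases "x \<in> A")
      case True
      have "c * \<bar>u x\<bar> \<le> \<bar>u x\<bar> powr (p - 1) * \<bar>u x\<bar>"
        unfolding c_def using in_A[OF True] p by (intro mult_right_mono powr_mono2') auto
      also have "\<dots> = \<bar>u x\<bar> powr p"
        using in_A(1)[OF True] powr_add[of "\<bar>u x\<bar>" "p - 1" 1] by simp
      finally show ?thesis using True by (simp add: h_def)
    qed (simp add: h_def)
  qed
  also have "(LINT x|M. \<bar>u x\<bar> powr p - c * \<bar>h x\<bar>) = q1 M p u - c * L1_norm M h"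
    unfolding q1_def L1_norm_def using int_h u p
    by (subst Bochner_Integration.integral_diff) (auto intro: integrable_abs_powr)
  finally have "c * L1_norm M h \<le> 0" by simp
  with c norm_pos show False by (simp add: mult_le_0_iff)
qed

end

text \<open>Here the numerator reduces to a value of \<open>q1\<close>, so every quotient is
  nonnegative, not just those with \<open>h\<close> near 0.\<close>

lemma AE_zero_in_frechet_subdiff:
  assumes "\<eta> \<in> Linf M" "AE x in M. \<eta> x = 0" "AE x in M. u x = 0"
  shows "\<eta> \<in> frechet_subdiff M (q1 M p) u"
proof -
  have "q1 M p u = 0"
    unfolding q1_def using assms(3) by (intro integral_eq_zero_AE) (auto elim: eventually_mono)
  moreover have "(LINT x|M. \<eta> x * h x) = 0" for h
    using assms(2) by (intro integral_eq_zero_AE) (auto elim: eventually_mono)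
  moreover have "0 \<le> q1 M p v" for v by (simp add: q1_def)
  moreover have "0 \<le> L1_norm M h" for h by (simp add: L1_norm_def)
  ultimately show ?thesis
    using assms(1) by (auto simp: frechet_subdiff_def intro!: Liminf_bounded)
qed

section \<open>Absence of atoms in Lebesgue measure\<close>

lemma ex_small_lebesgue_subset:
  fixes E :: "'a::euclidean_space set"
  assumes E: "E \<in> sets lebesgue" and pos: "0 < emeasure lebesgue E" and e: "0 < e"
  obtains A where "A \<in> sets lebesgue" "A \<subseteq> E" "0 < emeasure lebesgue A"
    "emeasure lebesgue A < ennreal e"
proof -
  have "((\<lambda>r. unit_ball_vol DIM('a) * r ^ DIM('a)) \<longlongrightarrow> unit_ball_vol DIM('a) * 0 ^ DIM('a))
      (at_right 0)"
    by (intro tendsto_intros)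
  then have "((\<lambda>r. unit_ball_vol DIM('a) * r ^ DIM('a)) \<longlongrightarrow> 0) (at_right 0)"
    \<comment> \<open>The limit is 0 because a Euclidean space has positive dimension.\<close>
    by (simp add: power_0_left)
  then have "\<forall>\<^sub>F r in at_right 0. unit_ball_vol DIM('a) * r ^ DIM('a) < e"
    using e by (rule order_tendstoD)
  then have "\<forall>\<^sub>F r in at_right 0. unit_ball_vol DIM('a) * r ^ DIM('a) < e \<and> 0 < r"
    using eventually_at_right_less by (rule eventually_conj)
  then obtain r where r: "unit_ball_vol DIM('a) * r ^ DIM('a) < e" "0 < r"
    using eventually_happens[of _ "at_right (0::real)"] by auto
  have ball_less: "emeasure lebesgue (ball x r) < ennreal e" for x :: 'a
    using r e by (simp add: emeasure_ball ennreal_lessI)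
  \<comment> \<open>Countably many balls of the one radius \<open>r\<close> cover the space. As
    \<open>E\<close> is not null, it meets one of them in a non-null set, and that ball has volume
    less than \<open>e\<close>.\<close>
  obtain \<B> where \<B>: "\<B> \<subseteq> range (\<lambda>x::'a. ball x r)" "countable \<B>" "\<Union>\<B> = \<Union>(range (\<lambda>x::'a. ball x r))"
    using Lindelof[of "range (\<lambda>x::'a. ball x r)"] by auto
  have cover: "\<Union>\<B> = UNIV" using \<B>(3) r(2) by auto
  have "\<exists>B\<in>\<B>. E \<inter> B \<notin> null_sets lebesgue"
  proof (rule ccontr)
    assume "\<not> ?thesis"
    then have "(\<Union>B\<in>\<B>. E \<inter> B) \<in> null_sets lebesgue"
      using \<B>(2) by (intro null_sets_UN') auto
    moreover have "(\<Union>B\<in>\<B>. E \<inter> B) = E" using cover by auto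
    ultimately show False using pos by auto
  qed
  then obtain x where x: "E \<inter> ball x r \<notin> null_sets lebesgue" using \<B>(1) by auto
  show thesis
  proof
    show A: "E \<inter> ball x r \<in> sets lebesgue" using E by auto
    show "0 < emeasure lebesgue (E \<inter> ball x r)"
      using x A by (simp add: null_sets_def zero_less_iff_neq_zero)
    have "emeasure lebesgue (E \<inter> ball x r) \<le> emeasure lebesgue (ball x r)"
      by (intro emeasure_mono) auto
    then show "emeasure lebesgue (E \<inter> ball x r) < ennreal e"
      using ball_less by (rule order_le_less_trans)
  qed simp
qed

lemma nonatomic_finite_measure_lebesgue_on:
  fixes \<Omega> :: "'a::euclidean_space set"
  assumes \<Omega>: "\<Omega> \<in> sets lebesgue" and fin: "emeasure lebesgue \<Omega> < \<infinity>"
  shows "nonatomic_finite_measure (lebesgue_on \<Omega>)"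
proof -
  interpret finite_measure "lebesgue_on \<Omega>"
    using assms by (intro finite_measureI) (simp add: emeasure_restrict_space)
  show ?thesis
  proof
    fix E and e :: real
    assume E: "E \<in> sets (lebesgue_on \<Omega>)" "0 < measure (lebesgue_on \<Omega>) E" and e: "0 < e"
    have E': "E \<in> sets lebesgue" "E \<subseteq> \<Omega>"
      using E(1) \<Omega> by (auto simp: sets_restrict_space_iff)
    \<comment> \<open>This holds even for nonmeasurable \<open>A\<close>, where both sides are
      0.\<close>
    have eq: "emeasure lebesgue A = ennreal (measure (lebesgue_on \<Omega>) A)" if "A \<subseteq> E" for A
      using that E'(2) \<Omega>
      by (subst emeasure_eq_measure[symmetric], subst emeasure_restrict_space) auto
    obtain A where A: "A \<in> sets lebesgue" "A \<subseteq> E" "0 < emeasure lebesgue A"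
        "emeasure lebesgue A < ennreal e"
      using ex_small_lebesgue_subset[OF E'(1) _ e] E(2) by (auto simp: eq)
    have "A \<in> sets (lebesgue_on \<Omega>)"
      using A(1,2) E'(2) \<Omega> by (auto simp: sets_restrict_space_iff)
    moreover have "0 < measure (lebesgue_on \<Omega>) A" "measure (lebesgue_on \<Omega>) A < e"
      using A(3,4) unfolding eq[OF A(2)] by (auto simp: ennreal_less_iff)
    ultimately show "\<exists>A \<in> sets (lebesgue_on \<Omega>). A \<subseteq> E \<and> 0 < measure (lebesgue_on \<Omega>) A \<and>
        measure (lebesgue_on \<Omega>) A < e"
      using A(2) by blast
  qed
qed

theorem theorem4p3:
  fixes \<Omega> :: "(real ^ 'd) set" and p :: real and u :: "real ^ 'd \<Rightarrow> real"
  assumes "\<Omega> \<in> sets lebesgue"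
    and "0 < emeasure lebesgue \<Omega>" and "emeasure lebesgue \<Omega> < \<infinity>"
    and "0 < p" and "p < 1"
    and "u \<in> L1 (lebesgue_on \<Omega>)"
  shows "frechet_subdiff (lebesgue_on \<Omega>) (q1 (lebesgue_on \<Omega>) p) u =
    (if AE x in lebesgue_on \<Omega>. u x = 0
     then {\<eta> \<in> Linf (lebesgue_on \<Omega>). AE x in lebesgue_on \<Omega>. \<eta> x = 0}
     else {})"
proof -
  interpret nonatomic_finite_measure "lebesgue_on \<Omega>"
    using assms(1,3) by (rule nonatomic_finite_measure_lebesgue_on)
  have u: "integrable (lebesgue_on \<Omega>) u" using assms(6) by (simp add: L1_def)
  let ?D = "frechet_subdiff (lebesgue_on \<Omega>) (q1 (lebesgue_on \<Omega>) p) u"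
  show ?thesis
  proof (cases "AE x in lebesgue_on \<Omega>. u x = 0")
    case True
    have "\<eta> \<in> Linf (lebesgue_on \<Omega>)" if "\<eta> \<in> ?D" for \<eta>
      using that by (simp add: frechet_subdiff_def)
    then have "?D = {\<eta> \<in> Linf (lebesgue_on \<Omega>). AE x in lebesgue_on \<Omega>. \<eta> x = 0}"
      using subgradient_AE_eq_0[OF _ u assms(4,5)]
        AE_zero_in_frechet_subdiff[OF _ _ True] by blast
    with True show ?thesis by simp
  next
    case False
    then have "?D = {}" using AE_eq_0_of_subgradient[OF _ u assms(4,5)] by blast
    with False show ?thesis by simp
  qed
qed

end
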